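(* Let $G$ be a finite Abelian group and let $\mathbb F$ be a field over which $G$ is fully representable. Let $\widehat{G}$ denote the set of all group homomorphisms $G\to\mathbb F^\times$. For any two $k$-element subsets $A=\{a_1,\ldots,a_k\}$ and $B=\{b_1,\ldots,b_k\}$ of $G$ there exist characters $\chi_1,\ldots,\chi_k\in\widehat{G}$ such that both $\det(\chi_i(a_j))_{1\le i,j\le k}$ and $\det(\chi_i(b_j))_{1\le i,j\le k}$ are different from zero.
   Context: Let $G$ be a finite Abelian group of exponent $n$. $G$ is called fully representable over a field $\mathbb F$ if the multiplicative group $\mathbb F^\times$ contains an element of order $n$. The characters of $G$ (over $\mathbb F$) are the group homomorphisms $G\to\mathbb F^\times$, with $G$ written additively. *)

theory Defs
  imports "Jordan_Normal_Form.Determinant"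
begin

(* The n-fold multiple of g in the additive group is written as a constant sum, since there is no
   scalar multiplication by naturals at the level of ab_group_add. A positive n of this kind exists
   because the type is finite. *)
definition group_exponent :: "'g::{finite,ab_group_add} itself \<Rightarrow> nat" where
  "group_exponent _ = (LEAST n. 0 < n \<and> (\<forall>g::'g. (\<Sum>i<n. g) = 0))"

(* A relation rather than a function, so that elements of infinite order have no order at all.
   For n > 0 the equation u ^ n = 1 already forces u to be nonzero. *)
definition has_mult_order :: "'f::field \<Rightarrow> nat \<Rightarrow> bool" where
  "has_mult_order u n \<longleftrightarrow> 0 < n \<and> u ^ n = 1 \<and> (\<forall>m. 0 < m \<and> m < n \<longrightarrow> u ^ m \<noteq> 1)"

definition fully_representable ::
    "'g::{finite,ab_group_add} itself \<Rightarrow> 'f::field itself \<Rightarrow> bool" where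
  "fully_representable _ _ \<longleftrightarrow> (\<exists>u::'f. has_mult_order u (group_exponent TYPE('g)))"

(* Homomorphisms from the additive group to the multiplicative group of nonzero field elements. *)
definition characters :: "('g::{finite,ab_group_add} \<Rightarrow> 'f::field) set" where
  "characters = {\<chi>. (\<forall>g. \<chi> g \<noteq> 0) \<and> (\<forall>g h. \<chi> (g + h) = \<chi> g * \<chi> h)}"

end

theory Submission
  imports Defs
begin

text \<open>For any function \<open>f\<close> on the group, expand \<open>f = (\<Sum>\<chi>. w\<^sub>\<chi> \<chi>)\<close> in characters. Then
  \<open>f (a\<^sub>i + b\<^sub>j) = (\<Sum>\<chi>. w\<^sub>\<chi> \<chi>(a\<^sub>i) \<chi>(b\<^sub>j))\<close>, so by Cauchy--Binet the determinant of \<open>f (a\<^sub>i + b\<^sub>j)\<close> is a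
  combination of products of a minor of \<open>\<chi>(a\<^sub>j)\<close> and the minor of \<open>\<chi>(b\<^sub>j)\<close> with the same characters.
  It therefore suffices to find \<open>f\<close> with nonzero determinant. As the field may be too small, \<open>f\<close> takes
  values \<open>t\<^sup>e\<close> in the polynomial ring, where the exponents \<open>e\<close> on the group are chosen greedily such that
  a single permutation attains the maximal degree in the Leibniz expansion.\<close>

section \<open>Determinants\<close>

lemma permutes_upt_less: "p permutes {0..<k} \<Longrightarrow> i < k \<Longrightarrow> p i < k" for k :: nat
  using permutes_in_image[of p "{0..<k}" i] by simp

text \<open>Row \<open>i\<close> is the combination of the rows \<open>v s\<close> with coefficients
  \<open>u s i\<close>, so this is multilinearity of the determinant in its rows;
  \<open>\<phi>\<close> chooses one summand per row.\<close>

lemma det_sum_rank_one: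
  fixes u v :: "'s \<Rightarrow> nat \<Rightarrow> 'a::comm_ring_1"
  assumes "finite S"
  shows "det (mat k k (\<lambda>(i, j). \<Sum>s\<in>S. u s i * v s j)) =
    (\<Sum>\<phi>\<in>{0..<k} \<rightarrow>\<^sub>E S. (\<Prod>i = 0..<k. u (\<phi> i) i) * det (mat k k (\<lambda>(i, j). v (\<phi> i) j)))"
proof -
  have "det (mat k k (\<lambda>(i, j). \<Sum>s\<in>S. u s i * v s j)) =
    (\<Sum>p | p permutes {0..<k}. signof p * (\<Prod>i = 0..<k. \<Sum>s\<in>S. u s i * v s (p i)))"
    unfolding det_def by (auto intro!: sum.cong prod.cong arg_cong2[where f = "(*)"] dest: permutes_upt_less)
  also have "\<dots> = (\<Sum>p | p permutes {0..<k}. \<Sum>\<phi>\<in>{0..<k} \<rightarrow>\<^sub>E S.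
      signof p * (\<Prod>i = 0..<k. u (\<phi> i) i * v (\<phi> i) (p i)))"
    using assms by (subst prod_sum_PiE) (auto simp: sum_distrib_left)
  also have "\<dots> = (\<Sum>\<phi>\<in>{0..<k} \<rightarrow>\<^sub>E S. \<Sum>p | p permutes {0..<k}.
      signof p * (\<Prod>i = 0..<k. u (\<phi> i) i * v (\<phi> i) (p i)))"
    by (rule sum.swap)
  also have "\<dots> = (\<Sum>\<phi>\<in>{0..<k} \<rightarrow>\<^sub>E S. (\<Prod>i = 0..<k. u (\<phi> i) i) *
      (\<Sum>p | p permutes {0..<k}. signof p * (\<Prod>i = 0..<k. v (\<phi> i) (p i))))"
    by (simp add: sum_distrib_left prod.distrib ac_simps)
  also have "\<dots> = (\<Sum>\<phi>\<in>{0..<k} \<rightarrow>\<^sub>E S. (\<Prod>i = 0..<k. u (\<phi> i) i) * det (mat k k (\<lambda>(i, j). v (\<phi> i) j)))"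
    unfolding det_def
    by (auto intro!: sum.cong prod.cong arg_cong2[where f = "(*)"] dest: permutes_upt_less)
  finally show ?thesis .
qed

text \<open>Selections with the same image as an injective one are its rearrangements. This turns a
  sum over all selections with a given image into a Leibniz sum. The \<open>restrict\<close> is
  there because members of \<open>PiE\<close> are \<open>undefined\<close> outside
  \<open>I\<close>.\<close>

lemma bij_betw_permutes_PiE_image:
  assumes "\<phi> \<in> I \<rightarrow>\<^sub>E S" and "inj_on \<phi> I" and "finite I"
  shows "bij_betw (\<lambda>p. restrict (\<phi> \<circ> p) I) {p. p permutes I}
           {\<psi> \<in> I \<rightarrow>\<^sub>E S. \<psi> ` I = \<phi> ` I}"
proof (rule bij_betwI')
  fix p q
  assume "p \<in> {p. p permutes I}" "q \<in> {p. p permutes I}"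
  then have p: "p permutes I" and q: "q permutes I" by auto
  have "p = q" if eq: "restrict (\<phi> \<circ> p) I = restrict (\<phi> \<circ> q) I"
  proof
    fix i
    show "p i = q i"
    proof (cases "i \<in> I")
      case True
      then have "\<phi> (p i) = \<phi> (q i)" using fun_cong[OF eq, of i] by simp
      then show ?thesis
        using assms(2) True permutes_in_image[OF p] permutes_in_image[OF q] by (auto dest: inj_onD)
    next
      case False
      then show ?thesis using p q by (simp add: permutes_not_in)
    qed
  qed
  then show "(restrict (\<phi> \<circ> p) I = restrict (\<phi> \<circ> q) I) = (p = q)" by blast
next
  fix p
  assume "p \<in> {p. p permutes I}"
  then have p: "p permutes I" by simp
  then show "restrict (\<phi> \<circ> p) I \<in> {\<psi> \<in> I \<rightarrow>\<^sub>E S. \<psi> ` I = \<phi> ` I}"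
    using assms(1) permutes_in_image[OF p] permutes_image[OF p] image_comp[of \<phi> p I]
    by (auto simp: PiE_iff comp_def)
next
  fix \<psi>
  assume "\<psi> \<in> {\<psi> \<in> I \<rightarrow>\<^sub>E S. \<psi> ` I = \<phi> ` I}"
  then have \<psi>: "\<psi> \<in> I \<rightarrow>\<^sub>E S" "\<psi> ` I = \<phi> ` I" by auto
  define p where "p i = (if i \<in> I then inv_into I \<phi> (\<psi> i) else i)" for i
  have p: "p i \<in> I" "\<phi> (p i) = \<psi> i" if "i \<in> I" for i
  proof -
    have "\<psi> i \<in> \<phi> ` I" using that \<psi>(2) by blast
    then show "p i \<in> I" "\<phi> (p i) = \<psi> i"
      using that by (auto simp: p_def inv_into_into f_inv_into_f)
  qed
  \<comment> \<open>The image of \<open>\<psi>\<close> is as large as the finite set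
    \<open>I\<close>, which makes \<open>\<psi>\<close> injective and hence \<open>p\<close>
    too.\<close>
  have "card (\<psi> ` I) = card I" using \<psi>(2) assms(2) by (simp add: card_image)
  then have "inj_on \<psi> I" using assms(3) by (simp add: eq_card_imp_inj_on)
  then have "inj_on p I" using p by (metis (no_types, lifting) inj_on_def)
  moreover have "p ` I \<subseteq> I" using p by auto
  ultimately have "bij_betw p I I" using assms(3) by (simp add: bij_betw_def endo_inj_surj)
  then have "p permutes I" by (rule bij_imp_permutes) (simp add: p_def)
  moreover have "\<psi> = restrict (\<phi> \<circ> p) I"
    using \<psi>(1) p by (auto simp: fun_eq_iff PiE_def extensional_def)
  ultimately show "\<exists>p\<in>{p. p permutes I}. \<psi> = restrict (\<phi> \<circ> p) I" by blast
qed

text \<open>The qualitative content of the Cauchy--Binet formula: grouping the expansion of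
 the determinant by the image of the selection yields products of two minors.\<close>

lemma common_nonzero_minor:
  fixes u v :: "'s \<Rightarrow> nat \<Rightarrow> 'a::comm_ring_1"
  assumes "finite S" and nz: "det (mat k k (\<lambda>(i, j). \<Sum>s\<in>S. w s * u s i * v s j)) \<noteq> 0"
  obtains \<phi> where "\<And>i. i < k \<Longrightarrow> \<phi> i \<in> S"
    and "det (mat k k (\<lambda>(i, j). u (\<phi> i) j)) \<noteq> 0"
    and "det (mat k k (\<lambda>(i, j). v (\<phi> i) j)) \<noteq> 0"
proof -
  let ?I = "{0..<k}"
  let ?P = "?I \<rightarrow>\<^sub>E S"
  let ?V = "\<lambda>\<phi>. mat k k (\<lambda>(i, j). v (\<phi> i) j)"
  let ?U = "\<lambda>\<phi>. mat k k (\<lambda>(i, j). u (\<phi> i) j)"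
  let ?t = "\<lambda>\<phi>. (\<Prod>i = 0..<k. w (\<phi> i) * u (\<phi> i) i) * det (?V \<phi>)"
  have fP: "finite ?P" using assms(1) by (simp add: finite_PiE)
  \<comment> \<open>The weights \<open>w\<close> are absorbed into the coefficients
    \<open>u\<close>.\<close>
  have "(\<Sum>\<phi>\<in>?P. ?t \<phi>) \<noteq> 0"
    using nz det_sum_rank_one[OF assms(1), of k "\<lambda>s i. w s * u s i" v] by simp
  then have "(\<Sum>T\<in>(\<lambda>\<phi>. \<phi> ` ?I) ` ?P. \<Sum>\<phi> | \<phi> \<in> ?P \<and> \<phi> ` ?I = T. ?t \<phi>) \<noteq> 0"
    using sum.image_gen[OF fP, of ?t "\<lambda>\<phi>. \<phi> ` ?I"] by simp
  then obtain T where T: "(\<Sum>\<phi> | \<phi> \<in> ?P \<and> \<phi> ` ?I = T. ?t \<phi>) \<noteq> 0"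
    by (meson sum.not_neutral_contains_not_neutral)
  \<comment> \<open>A nonzero term fixes a representative \<open>\<phi>\<close> of its group; the
    other members are expressed through it below.\<close>
  then obtain \<phi> where \<phi>: "\<phi> \<in> ?P" "\<phi> ` ?I = T" "?t \<phi> \<noteq> 0"
    by (smt (verit) mem_Collect_eq sum.not_neutral_contains_not_neutral)
  then have V: "det (?V \<phi>) \<noteq> 0" by auto
  have inj: "inj_on \<phi> ?I"
  proof (rule inj_onI, rule ccontr)
    fix i j
    assume "i \<in> ?I" "j \<in> ?I" "\<phi> i = \<phi> j" "i \<noteq> j"
    then have "det (?V \<phi>) = 0"
      by (intro det_identical_rows[of _ k i j]) (auto intro!: eq_vecI)
    with V show False by simp
  qed
  \<comment> \<open>Rearranging the selection permutes the rows of \<open>?V \<phi>\<close>, which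
    costs only a sign, and leaves the product of the weights unchanged. Hence
    \<open>det (?V \<phi>)\<close> factors out of the whole group.\<close>
  have tp: "?t (restrict (\<phi> \<circ> p) ?I) =
      (\<Prod>i = 0..<k. w (\<phi> i)) * det (?V \<phi>) * (signof p * (\<Prod>i = 0..<k. u (\<phi> (p i)) i))"
    if p: "p permutes ?I" for p
  proof -
    have "?V (restrict (\<phi> \<circ> p) ?I) = mat k k (\<lambda>(i, j). ?V \<phi> $$ (p i, j))"
      using p by (auto intro!: eq_matI dest: permutes_upt_less)
    then have "det (?V (restrict (\<phi> \<circ> p) ?I)) = signof p * det (?V \<phi>)"
      using det_permute_rows[of "?V \<phi>" k p] p by simp
    moreover have "(\<Prod>i = 0..<k. w (\<phi> (p i))) = (\<Prod>i = 0..<k. w (\<phi> i))"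
      using prod.permute[OF p, of "\<lambda>i. w (\<phi> i)"] by (simp add: comp_def)
    ultimately show ?thesis by (simp add: prod.distrib ac_simps)
  qed
  have "(\<Sum>\<phi> | \<phi> \<in> ?P \<and> \<phi> ` ?I = T. ?t \<phi>) =
      (\<Sum>p | p permutes ?I. ?t (restrict (\<phi> \<circ> p) ?I))"
    using sum.reindex_bij_betw[OF bij_betw_permutes_PiE_image[OF \<phi>(1) inj], of ?t] \<phi>(2) by simp
  also have "\<dots> = (\<Prod>i = 0..<k. w (\<phi> i)) * det (?V \<phi>) *
      (\<Sum>p | p permutes ?I. signof p * (\<Prod>i = 0..<k. u (\<phi> (p i)) i))"
    unfolding sum_distrib_left by (rule sum.cong) (use tp in auto)
  \<comment> \<open>Leibniz formula with the permutation acting on the row index.\<close>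
  also have "(\<Sum>p | p permutes ?I. signof p * (\<Prod>i = 0..<k. u (\<phi> (p i)) i)) = det (?U \<phi>)"
    by (subst mat_det_left_def[of _ k])
      (auto intro!: sum.cong prod.cong arg_cong2[where f = "(*)"] dest: permutes_upt_less)
  finally have "det (?U \<phi>) \<noteq> 0" using T by auto
  with V that[of \<phi>] \<phi>(1) show thesis by (auto simp: PiE_iff)
qed

section \<open>Weights on a table with a unique heaviest matching\<close>

text \<open>Give one occurring symbol \<open>x\<close> a weight exceeding all others together. Since \<open>x\<close> occurs at most
  once per row and column, a heaviest matching must use all its cells; what remains is a smaller
  table not containing \<open>x\<close>.\<close>

lemma unique_heaviest_matching:
  fixes c :: "'i \<Rightarrow> 'j \<Rightarrow> 's"
  assumes "finite I" and "finite J" and "card I = card J"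
    and "\<And>i. i \<in> I \<Longrightarrow> inj_on (c i) J" and "\<And>j. j \<in> J \<Longrightarrow> inj_on (\<lambda>i. c i j) I"
  shows "\<exists>(e :: 's \<Rightarrow> nat) \<sigma>. bij_betw \<sigma> I J \<and>
    (\<forall>\<pi>. bij_betw \<pi> I J \<and> (\<exists>i\<in>I. \<pi> i \<noteq> \<sigma> i) \<longrightarrow> (\<Sum>i\<in>I. e (c i (\<pi> i))) < (\<Sum>i\<in>I. e (c i (\<sigma> i))))"
  using assms
proof (induction "card I" arbitrary: I J rule: less_induct)
  case less
  note fin = less.prems(1,2)
  show ?case
  proof (cases "I = {}")
    case True
    with less.prems show ?thesis by (auto simp: bij_betw_def)
  next
    case False
    then obtain i0 j0 where ij0: "i0 \<in> I" "j0 \<in> J"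
      using less.prems by (metis card_0_eq ex_in_conv)
    define x where "x = c i0 j0"
    define D where "D = {i \<in> I. \<exists>j\<in>J. c i j = x}"
    obtain m where m: "\<And>i. i \<in> D \<Longrightarrow> m i \<in> J \<and> c i (m i) = x"
      using bchoice[of D "\<lambda>i j. j \<in> J \<and> c i j = x"] by (auto simp: D_def)
    have D: "D \<subseteq> I" "finite D" "i0 \<in> D" using fin ij0 by (auto simp: D_def x_def)
    \<comment> \<open>Rows have distinct entries, so the cells \<open>(i, m i)\<close> with
      \<open>i\<close> in \<open>D\<close> are all the cells containing \<open>x\<close>.\<close>
    have mu: "i \<in> D \<and> j = m i" if "i \<in> I" "j \<in> J" "c i j = x" for i j
    proof -
      have "i \<in> D" using that by (auto simp: D_def)
      moreover have "j = m i"
        using less.prems(4)[OF that(1)] m[OF \<open>i \<in> D\<close>] that by (auto dest: inj_onD)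
      ultimately show ?thesis by simp
    qed
    have injm: "inj_on m D"
    proof (rule inj_onI)
      fix i i' assume "i \<in> D" "i' \<in> D" "m i = m i'"
      then show "i = i'"
        using m[of i] m[of i'] D less.prems(5)[of "m i"] by (auto dest: inj_onD)
    qed
    define I' where "I' = I - D"
    define J' where "J' = J - m ` D"
    have mD: "m ` D \<subseteq> J" using m by auto
    have "\<exists>(e :: 's \<Rightarrow> nat) \<sigma>. bij_betw \<sigma> I' J' \<and> (\<forall>\<pi>. bij_betw \<pi> I' J' \<and> (\<exists>i\<in>I'. \<pi> i \<noteq> \<sigma> i) \<longrightarrow>
        (\<Sum>i\<in>I'. e (c i (\<pi> i))) < (\<Sum>i\<in>I'. e (c i (\<sigma> i))))"
    proof (rule less.hyps)
      show "card I' < card I" unfolding I'_def using D fin ij0 by (intro psubset_card_mono) auto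
      show "card I' = card J'"
        unfolding I'_def J'_def using D mD fin less.prems(3) injm
        by (simp add: card_Diff_subset card_image finite_subset)
      show "inj_on (c i) J'" if "i \<in> I'" for i
        using less.prems(4) that by (auto simp: I'_def J'_def intro: inj_on_subset)
      show "inj_on (\<lambda>i. c i j) I'" if "j \<in> J'" for j
        using less.prems(5) that by (auto simp: I'_def J'_def intro: inj_on_subset)
      show "finite I'" "finite J'" using fin by (auto simp: I'_def J'_def)
    qed
    then obtain e' :: "'s \<Rightarrow> nat" and \<sigma>' where \<sigma>': "bij_betw \<sigma>' I' J'"
      and max': "\<And>\<pi>. bij_betw \<pi> I' J' \<Longrightarrow> \<exists>i\<in>I'. \<pi> i \<noteq> \<sigma>' i \<Longrightarrow>
          (\<Sum>i\<in>I'. e' (c i (\<pi> i))) < (\<Sum>i\<in>I'. e' (c i (\<sigma>' i)))"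
      by blast
    \<comment> \<open>The \<open>Suc\<close> makes \<open>L\<close> exceed the
      \<open>e'\<close>-weight of the whole table, hence of every matching.\<close>
    define L where "L = Suc (\<Sum>i\<in>I. \<Sum>j\<in>J. e' (c i j))"
    \<comment> \<open>Overwriting \<open>e'\<close> at \<open>x\<close> does not affect the smaller
      table, none of whose cells contains \<open>x\<close>.\<close>
    define e where "e = e'(x := L)"
    define \<sigma> where "\<sigma> i = (if i \<in> D then m i else \<sigma>' i)" for i
    have \<sigma>: "bij_betw \<sigma> I J"
    proof -
      have "bij_betw \<sigma> D (m ` D)"
        using injm by (auto simp: bij_betw_def \<sigma>_def inj_on_def)
      moreover have "bij_betw \<sigma> I' J'"
        using \<sigma>' by (rule bij_betw_cong[THEN iffD1, rotated]) (auto simp: \<sigma>_def I'_def)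
      ultimately have "bij_betw \<sigma> (D \<union> I') (m ` D \<union> J')"
        by (rule bij_betw_combine) (auto simp: J'_def)
      moreover have "D \<union> I' = I" "m ` D \<union> J' = J" using D mD by (auto simp: I'_def J'_def)
      ultimately show ?thesis by simp
    qed
    have weight: "(\<Sum>i\<in>I. e (c i (\<pi> i))) =
        card {i \<in> I. c i (\<pi> i) = x} * L + (\<Sum>i\<in>I - {i \<in> I. c i (\<pi> i) = x}. e' (c i (\<pi> i)))" for \<pi>
    proof -
      let ?P = "{i \<in> I. c i (\<pi> i) = x}"
      have "(\<Sum>i\<in>I. e (c i (\<pi> i))) = (\<Sum>i\<in>I - ?P. e (c i (\<pi> i))) + (\<Sum>i\<in>?P. e (c i (\<pi> i)))"
        using fin by (intro sum.subset_diff) auto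
      moreover have "(\<Sum>i\<in>?P. e (c i (\<pi> i))) = card ?P * L" by (simp add: e_def)
      moreover have "(\<Sum>i\<in>I - ?P. e (c i (\<pi> i))) = (\<Sum>i\<in>I - ?P. e' (c i (\<pi> i)))"
        by (rule sum.cong) (auto simp: e_def)
      ultimately show ?thesis by simp
    qed
    have "{i \<in> I. c i (\<sigma> i) = x} = D"
    proof (intro equalityI subsetI)
      fix i assume i: "i \<in> {i \<in> I. c i (\<sigma> i) = x}"
      then have "\<sigma> i \<in> J" using \<sigma> by (auto simp: bij_betw_def)
      then show "i \<in> D" using mu[of i "\<sigma> i"] i by simp
    qed (use m D(1) in \<open>auto simp: \<sigma>_def\<close>)
    then have w\<sigma>: "(\<Sum>i\<in>I. e (c i (\<sigma> i))) = card D * L + (\<Sum>i\<in>I'. e' (c i (\<sigma>' i)))"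
      using weight[of \<sigma>] by (simp add: I'_def[symmetric]) (auto simp: I'_def \<sigma>_def intro: sum.cong)
    have "(\<Sum>i\<in>I. e (c i (\<pi> i))) < (\<Sum>i\<in>I. e (c i (\<sigma> i)))"
      if \<pi>: "bij_betw \<pi> I J" and ne: "\<exists>i\<in>I. \<pi> i \<noteq> \<sigma> i" for \<pi>
    proof -
      let ?P = "{i \<in> I. c i (\<pi> i) = x}"
      have \<pi>J: "\<pi> i \<in> J" if "i \<in> I" for i using \<pi> that by (auto simp: bij_betw_def)
      have P: "i \<in> D" "\<pi> i = m i" if "i \<in> ?P" for i using mu[of i "\<pi> i"] \<pi>J[of i] that by auto
      show ?thesis
      proof (cases "?P = D")
        \<comment> \<open>Here \<open>\<pi>\<close> agrees with \<open>\<sigma>\<close> on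
          \<open>D\<close>, so the two differ on the smaller table, where the induction hypothesis
          decides.\<close>
        case True
        then have eq: "\<pi> i = m i" if "i \<in> D" for i using P(2) that by blast
        then have "\<pi> ` D = m ` D" by (rule image_cong[OF refl])
        moreover have "inj_on \<pi> I" "\<pi> ` I = J" using \<pi> by (auto simp: bij_betw_def)
        ultimately have "\<pi> ` I' = J'" "inj_on \<pi> I'"
          using inj_on_image_set_diff[of \<pi> I I D] D(1)
          by (auto simp: I'_def J'_def Diff_subset intro: inj_on_subset)
        then have "bij_betw \<pi> I' J'" by (simp add: bij_betw_def)
        moreover have "\<exists>i\<in>I'. \<pi> i \<noteq> \<sigma>' i"
          using ne eq by (auto simp: \<sigma>_def I'_def split: if_splits)
        ultimately have "(\<Sum>i\<in>I'. e' (c i (\<pi> i))) < (\<Sum>i\<in>I'. e' (c i (\<sigma>' i)))" by (rule max')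
        then show ?thesis using weight[of \<pi>] w\<sigma> True by (simp add: I'_def)
      next
        case False
        \<comment> \<open>A missing cell of \<open>x\<close> costs \<open>L\<close>, more than all
          other cells of \<open>\<pi>\<close> contribute together.\<close>
        then have "?P \<subset> D" using P(1) by blast
        then have "card ?P < card D" using D(2) by (rule psubset_card_mono[rotated])
        then have "Suc (card ?P) * L \<le> card D * L" by (intro mult_le_mono1) simp
        moreover have "(\<Sum>i\<in>I - ?P. e' (c i (\<pi> i))) \<le> (\<Sum>i\<in>I. e' (c i (\<pi> i)))"
          using fin by (intro sum_mono2) auto
        moreover have "\<dots> \<le> (\<Sum>i\<in>I. \<Sum>j\<in>J. e' (c i j))"
          using fin \<pi>J by (intro sum_mono member_le_sum) auto
        ultimately show ?thesis using weight[of \<pi>] w\<sigma> by (simp add: L_def)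
      qed
    qed
    with \<sigma> have "bij_betw \<sigma> I J \<and> (\<forall>\<pi>. bij_betw \<pi> I J \<and> (\<exists>i\<in>I. \<pi> i \<noteq> \<sigma> i) \<longrightarrow>
        (\<Sum>i\<in>I. e (c i (\<pi> i))) < (\<Sum>i\<in>I. e (c i (\<sigma> i))))"
      by simp
    then show ?thesis by (intro exI)
  qed
qed

section \<open>Nonzero determinants over the polynomial ring\<close>

lemma prod_monom_one:
  "(\<Prod>i\<in>I. monom (1::'a::comm_semiring_1) (h i)) = monom 1 (\<Sum>i\<in>I. h i)"
  by (induction I rule: infinite_finite_induct) (auto simp: mult_monom)

text \<open>If \<open>f\<close> sends \<open>s\<close> to the monomial of degree \<open>e s\<close>,
  every Leibniz term is a signed monomial whose degree is the weight of its permutation. The largest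
  weight occurs once, so the coefficient there is a sign.\<close>

lemma exists_nonzero_det_poly:
  fixes c :: "nat \<Rightarrow> nat \<Rightarrow> 's"
  assumes row: "\<And>i. i < k \<Longrightarrow> inj_on (c i) {0..<k}"
    and col: "\<And>j. j < k \<Longrightarrow> inj_on (\<lambda>i. c i j) {0..<k}"
  shows "\<exists>f :: 's \<Rightarrow> 'a::comm_ring_1 poly. det (mat k k (\<lambda>(i, j). f (c i j))) \<noteq> 0"
proof -
  let ?I = "{0..<k}"
  have "\<exists>(e :: 's \<Rightarrow> nat) \<sigma>. bij_betw \<sigma> ?I ?I \<and> (\<forall>\<pi>. bij_betw \<pi> ?I ?I \<and> (\<exists>i\<in>?I. \<pi> i \<noteq> \<sigma> i) \<longrightarrow>
      (\<Sum>i\<in>?I. e (c i (\<pi> i))) < (\<Sum>i\<in>?I. e (c i (\<sigma> i))))"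
    by (rule unique_heaviest_matching) (use row col in auto)
  then obtain e :: "'s \<Rightarrow> nat" and \<sigma> where \<sigma>: "bij_betw \<sigma> ?I ?I"
    and max: "\<And>\<pi>. bij_betw \<pi> ?I ?I \<Longrightarrow> \<exists>i\<in>?I. \<pi> i \<noteq> \<sigma> i \<Longrightarrow>
        (\<Sum>i\<in>?I. e (c i (\<pi> i))) < (\<Sum>i\<in>?I. e (c i (\<sigma> i)))"
    by blast
  \<comment> \<open>\<open>permutes\<close> demands the identity outside \<open>?I\<close>, which
    \<open>\<sigma>\<close> need not satisfy.\<close>
  define q where "q i = (if i \<in> ?I then \<sigma> i else i)" for i
  have q: "q permutes ?I"
    by (rule bij_imp_permutes[OF bij_betw_cong[THEN iffD1, OF _ \<sigma>]]) (auto simp: q_def)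
  let ?w = "\<lambda>p. \<Sum>i = 0..<k. e (c i (p i))"
  have wq: "?w q = (\<Sum>i\<in>?I. e (c i (\<sigma> i)))" by (rule sum.cong) (auto simp: q_def)
  have less: "?w p < ?w q" if "p permutes ?I" "p \<noteq> q" for p
  proof -
    obtain i where "p i \<noteq> q i" using \<open>p \<noteq> q\<close> by auto
    moreover from this have "i \<in> ?I" using that(1) q by (metis permutes_not_in)
    ultimately have "\<exists>i\<in>?I. p i \<noteq> \<sigma> i" by (auto simp: q_def)
    then show ?thesis using max permutes_imp_bij[OF that(1)] wq by simp
  qed
  let ?M = "mat k k (\<lambda>(i, j). monom (1::'a) (e (c i j)))"
  have "det ?M = (\<Sum>p | p permutes ?I. signof p * monom 1 (?w p))"
    unfolding det_def prod_monom_one[symmetric]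
    by (auto intro!: sum.cong prod.cong arg_cong2[where f = "(*)"] dest: permutes_upt_less)
  then have "coeff (det ?M) (?w q) =
      (\<Sum>p | p permutes ?I. coeff (signof p * monom (1::'a) (?w p)) (?w q))"
    by (simp add: coeff_sum)
  also have "\<dots> = (\<Sum>p | p permutes ?I. if p = q then signof q else 0)"
    by (rule sum.cong) (use less in \<open>auto simp: sign_def dest: less_imp_neq\<close>)
  also have "\<dots> = signof q" using q by (simp add: finite_permutations)
  finally have "coeff (det ?M) (?w q) \<noteq> 0" by (simp add: sign_def)
  then have "det ?M \<noteq> 0" by auto
  then show ?thesis by (intro exI[of _ "\<lambda>s. monom 1 (e s)"])
qed

section \<open>Characters\<close>

definition nmul :: "nat \<Rightarrow> 'g::ab_group_add \<Rightarrow> 'g" where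
  "nmul n g = (\<Sum>i<n. g)"

lemma nmul_0 [simp]: "nmul 0 g = 0"
  and nmul_Suc [simp]: "nmul (Suc n) g = g + nmul n g"
  by (simp_all add: nmul_def add.commute)

lemma nmul_add: "nmul (m + n) g = nmul m g + nmul n g"
  by (induction m) (auto simp: add.assoc)

lemma nmul_mult: "nmul (m * n) g = nmul m (nmul n g)"
  by (induction m) (auto simp: nmul_add)

lemma nmul_zero [simp]: "nmul n 0 = 0"
  by (induction n) auto

text \<open>By the pigeonhole principle two multiples of each \<open>h\<close> coincide, so a
  positive multiple of \<open>h\<close> vanishes. The product of these multipliers over all
  \<open>h\<close> annihilates the group and is a witness for \<open>LEAST\<close>.\<close>

lemma
  fixes g :: "'g::{finite,ab_group_add}"
  shows group_exponent_pos: "0 < group_exponent TYPE('g)"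
    and nmul_group_exponent: "nmul (group_exponent TYPE('g)) g = 0"
proof -
  have "\<exists>m>0. nmul m h = 0" for h :: 'g
  proof -
    have "\<not> inj (\<lambda>m. nmul m h)" using finite_imageD[of "\<lambda>m. nmul m h" UNIV] by auto
    then obtain i j where "i \<noteq> j" "nmul i h = nmul j h" by (auto simp: inj_def)
    then obtain i j where ij: "i < j" "nmul i h = nmul j h" by (metis nat_neq_iff)
    then have "nmul i h + 0 = nmul i h + nmul (j - i) h"
      using nmul_add[of i "j - i" h] by simp
    then have "nmul (j - i) h = 0" by (metis add_left_cancel)
    then show ?thesis using ij by (intro exI[of _ "j - i"]) simp
  qed
  then obtain m :: "'g \<Rightarrow> nat" where m: "\<And>h. 0 < m h \<and> nmul (m h) h = 0" by metis
  have "nmul (\<Prod>h\<in>UNIV. m h) h = 0" for h :: 'g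
  proof -
    have "(\<Prod>h\<in>UNIV. m h) = (\<Prod>h\<in>UNIV - {h}. m h) * m h"
      by (subst prod.remove[of _ h]) auto
    then show ?thesis using m by (simp add: nmul_mult)
  qed
  moreover have "0 < (\<Prod>h\<in>UNIV. m h)" using m by (auto intro: prod_pos)
  ultimately have "0 < group_exponent TYPE('g) \<and> (\<forall>g::'g. nmul (group_exponent TYPE('g)) g = 0)"
    unfolding group_exponent_def nmul_def[symmetric]
    by (intro LeastI[of "\<lambda>n. 0 < n \<and> (\<forall>g::'g. nmul n g = 0)"]) blast
  then show "0 < group_exponent TYPE('g)" "nmul (group_exponent TYPE('g)) g = 0" by auto
qed

section \<open>Roots of unity in the field\<close>

lemma has_mult_order_dvd:
  assumes "has_mult_order u n" and "u ^ l = 1"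
  shows "n dvd l"
proof -
  have "u ^ (n * (l div n) + l mod n) = 1" using assms(2) by simp
  then have "u ^ (l mod n) = 1"
    using assms(1) unfolding power_add power_mult by (simp add: has_mult_order_def)
  moreover have "l mod n < n" using assms(1) by (simp add: has_mult_order_def)
  ultimately show ?thesis using assms(1) by (auto simp: has_mult_order_def dvd_eq_mod_eq_0)
qed

text \<open>The first \<open>n\<close> powers of \<open>u\<close> are distinct roots of
  \<open>monom 1 n - 1\<close>, which has at most \<open>n\<close> roots in a field, so they exhaust
  the roots.\<close>

lemma has_mult_order_root:
  fixes u v :: "'f::field"
  assumes u: "has_mult_order u n" and v: "v ^ n = 1"
  shows "\<exists>j. v = u ^ j"
proof -
  have n: "0 < n" and un: "u ^ n = 1" and u0: "u \<noteq> 0"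
    using u by (auto simp: has_mult_order_def zero_power)
  let ?p = "monom (1::'f) n - 1"
  have "coeff ?p n = 1" using n by (simp add: coeff_eq_0)
  then have p0: "?p \<noteq> 0" by (metis coeff_0 zero_neq_one)
  have "degree ?p \<le> n" by (rule degree_diff_le) (auto simp: degree_monom_le)
  have roots: "{x. poly ?p x = 0} = {x. x ^ n = 1}" by (simp add: poly_monom)
  have "inj_on (\<lambda>j. u ^ j) {..<n}"
  proof (rule linorder_inj_onI)
    fix i j assume ij: "i < j" "i \<in> {..<n}" "j \<in> {..<n}"
    show "u ^ i \<noteq> u ^ j"
    proof
      assume "u ^ i = u ^ j"
      then have "u ^ i * 1 = u ^ i * u ^ (j - i)" using ij power_add[of u i "j - i"] by simp
      then have "u ^ (j - i) = 1" using u0 by simp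
      moreover have "0 < j - i" "j - i < n" using ij by auto
      ultimately show False using u by (auto simp: has_mult_order_def)
    qed
  qed auto
  then have "card ((\<lambda>j. u ^ j) ` {..<n}) = n" by (simp add: card_image)
  moreover have "(\<lambda>j. u ^ j) ` {..<n} \<subseteq> {x. x ^ n = 1}"
    using un by (auto simp: power_mult[symmetric] mult.commute[of _ n]) (simp add: power_mult)
  moreover have "finite {x::'f. x ^ n = 1}" "card {x::'f. x ^ n = 1} \<le> n"
    using poly_roots_finite[OF p0] card_poly_roots_bound[OF p0] \<open>degree ?p \<le> n\<close>
    unfolding roots by auto
  ultimately have "(\<lambda>j. u ^ j) ` {..<n} = {x. x ^ n = 1}" by (metis card_seteq)
  then show ?thesis using v by blast
qed

section \<open>Extension of characters from subgroups\<close>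

text \<open>In a finite group closure under addition already makes a subgroup.\<close>

definition add_subgroup :: "'g::{finite,ab_group_add} set \<Rightarrow> bool" where
  "add_subgroup H \<longleftrightarrow> 0 \<in> H \<and> (\<forall>g\<in>H. \<forall>h\<in>H. g + h \<in> H)"

text \<open>Values outside \<open>H\<close> are left free, so extending a character means agreeing
  with it on \<open>H\<close> only.\<close>

definition character_on :: "'g::{finite,ab_group_add} set \<Rightarrow> ('g \<Rightarrow> 'f::field) \<Rightarrow> bool" where
  "character_on H \<chi> \<longleftrightarrow> (\<forall>g\<in>H. \<chi> g \<noteq> 0) \<and> (\<forall>g\<in>H. \<forall>h\<in>H. \<chi> (g + h) = \<chi> g * \<chi> h)"

lemma characters_eq: "\<chi> \<in> characters \<longleftrightarrow> character_on UNIV \<chi>"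
  by (auto simp: characters_def character_on_def)

lemma add_subgroup_nmul: "add_subgroup H \<Longrightarrow> g \<in> H \<Longrightarrow> nmul n g \<in> H"
  by (induction n) (auto simp: add_subgroup_def)

text \<open>Negatives are natural multiples: if the exponent is \<open>Suc n\<close>, then
  \<open>- h\<close> equals \<open>nmul n h\<close>.\<close>

lemma add_subgroup_minus:
  assumes H: "add_subgroup H" and "g \<in> H" "h \<in> (H :: 'g::{finite,ab_group_add} set)"
  shows "g - h \<in> H"
proof -
  obtain n where "group_exponent TYPE('g) = Suc n"
    using group_exponent_pos[where 'g = 'g] gr0_implies_Suc by blast
  then have "h + nmul n h = 0" using nmul_group_exponent[of h] by simp
  then have "g - h = g + nmul n h" by (simp add: algebra_simps eq_neg_iff_add_eq_0)
  moreover have "g + nmul n h \<in> H"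
    using H assms add_subgroup_nmul[OF H, of h n] by (auto simp: add_subgroup_def)
  ultimately show ?thesis by (simp only:)
qed

lemma character_on_zero:
  assumes "add_subgroup H" "character_on H \<chi>"
  shows "\<chi> 0 = 1"
proof -
  have "\<chi> (0 + 0) = \<chi> 0 * \<chi> 0" "\<chi> 0 \<noteq> 0"
    using assms unfolding add_subgroup_def character_on_def by blast+
  then show ?thesis by simp
qed

lemma character_on_nmul:
  assumes "add_subgroup H" "character_on H \<chi>" "g \<in> H"
  shows "\<chi> (nmul n g) = \<chi> g ^ n"
  by (induction n)
    (use assms character_on_zero[OF assms(1,2)] add_subgroup_nmul[OF assms(1,3)] in
      \<open>auto simp: character_on_def\<close>)

text \<open>\<open>m\<close> is the order of \<open>x\<close> modulo \<open>H\<close>. The group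
  exponent shows that the minimum exists, and division with remainder gives the
  divisibility.\<close>

lemma relative_order:
  fixes x :: "'g::{finite,ab_group_add}"
  assumes H: "add_subgroup H"
  defines "m \<equiv> LEAST m. 0 < m \<and> nmul m x \<in> H"
  shows "0 < m" and "nmul m x \<in> H" and "\<And>j. nmul j x \<in> H \<Longrightarrow> m dvd j"
proof -
  have "0 < m \<and> nmul m x \<in> H"
    unfolding m_def
    by (rule LeastI[of _ "group_exponent TYPE('g)"])
      (use H in \<open>simp add: group_exponent_pos nmul_group_exponent add_subgroup_def\<close>)
  then show m: "0 < m" "nmul m x \<in> H" by auto
  fix j assume j: "nmul j x \<in> H"
  have "nmul j x = nmul (j div m * m) x + nmul (j mod m) x" by (simp add: nmul_add[symmetric])
  then have "nmul (j mod m) x = nmul j x - nmul (j div m) (nmul m x)" by (simp add: nmul_mult)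
  then have "nmul (j mod m) x \<in> H"
    using add_subgroup_minus[OF H j add_subgroup_nmul[OF H m(2)]] by simp
  moreover have "j mod m < m" using m(1) by simp
  ultimately have "j mod m = 0"
    using not_less_Least[of "j mod m" "\<lambda>m. 0 < m \<and> nmul m x \<in> H"] by (auto simp: m_def)
  then show "m dvd j" by auto
qed

text \<open>On the subgroup generated by \<open>H\<close> and \<open>x\<close>, the extension sends
  \<open>h + nmul j x\<close> to \<open>\<chi> h * y ^ j\<close>. The equation for
  \<open>y ^ m\<close> makes this independent of the representation, so any such root
  \<open>y\<close> can be prescribed at \<open>x\<close>.\<close>

lemma character_on_extend_step:
  fixes H :: "'g::{finite,ab_group_add} set" and \<chi> :: "'g \<Rightarrow> 'f::field"
  assumes H: "add_subgroup H" and \<chi>: "character_on H \<chi>"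
    and m: "0 < m" "nmul m x \<in> H" "\<And>j. nmul j x \<in> H \<Longrightarrow> m dvd j"
    and y: "y ^ m = \<chi> (nmul m x)"
  obtains H' \<chi>' where "add_subgroup H'" "character_on H' \<chi>'" "H \<subseteq> H'" "x \<in> H'"
    "\<And>g. g \<in> H \<Longrightarrow> \<chi>' g = \<chi> g" "\<chi>' x = y"
proof -
  have y0: "y \<noteq> 0"
    using y m \<chi> by (auto simp: character_on_def zero_power)
  \<comment> \<open>For two representations of one element, \<open>nmul (j - i) x\<close> lies in
    \<open>H\<close>. Thus \<open>m\<close> divides \<open>j - i\<close>, and \<open>\<chi>\<close>
    takes the value \<open>y ^ (j - i)\<close> there. Assuming \<open>i \<le> j\<close> keeps the
    subtraction exact.\<close>
  have le: "\<chi> h * y ^ i = \<chi> h' * y ^ j"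
    if "h \<in> H" "h' \<in> H" "h + nmul i x = h' + nmul j x" "i \<le> j" for h h' i j
  proof -
    have "nmul j x = nmul i x + nmul (j - i) x" using that(4) by (simp add: nmul_add[symmetric])
    then have eq: "h = h' + nmul (j - i) x" using that(3) by (simp add: algebra_simps)
    then have d: "nmul (j - i) x \<in> H"
      using add_subgroup_minus[OF H that(1,2)] by simp
    then obtain l where l: "j - i = l * m" using m(3) by (auto simp: dvd_def mult.commute)
    have "\<chi> (nmul (j - i) x) = y ^ (j - i)"
      using character_on_nmul[OF H \<chi> m(2), of l]
      by (simp add: l nmul_mult y[symmetric] power_mult[symmetric] mult.commute)
    moreover have "\<chi> h = \<chi> h' * \<chi> (nmul (j - i) x)"
      using eq d that \<chi> by (simp add: character_on_def)
    ultimately show ?thesis using that(4) by (simp add: power_add[symmetric] mult.assoc)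
  qed
  have wd: "\<chi> h * y ^ i = \<chi> h' * y ^ j"
    if "h \<in> H" "h' \<in> H" "h + nmul i x = h' + nmul j x" for h h' i j
    using le[of h h' i j] le[of h' h j i] that by (metis linorder_le_cases)
  define H' where "H' = {h + nmul j x | h j. h \<in> H}"
  define \<chi>' where "\<chi>' g = (THE z. \<exists>h\<in>H. \<exists>j. g = h + nmul j x \<and> z = \<chi> h * y ^ j)" for g
  have \<chi>': "\<chi>' (h + nmul j x) = \<chi> h * y ^ j" if "h \<in> H" for h j
    unfolding \<chi>'_def
  proof (rule the_equality)
    fix z assume "\<exists>h'\<in>H. \<exists>j'. h + nmul j x = h' + nmul j' x \<and> z = \<chi> h' * y ^ j'"
    then show "z = \<chi> h * y ^ j" using wd[OF that] by metis
  qed (use that in blast)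
  have H0: "0 \<in> H" using H by (simp add: add_subgroup_def)
  have sum: "(h + nmul j x) + (h' + nmul j' x) = (h + h') + nmul (j + j') x" for h h' j j'
    by (simp add: nmul_add algebra_simps)
  show thesis
  proof
    show "add_subgroup H'"
      unfolding add_subgroup_def
    proof (intro conjI ballI)
      show "0 \<in> H'" using H0 unfolding H'_def by (auto intro!: exI[of _ 0])
      fix g g' assume "g \<in> H'" "g' \<in> H'"
      then obtain h j h' j' where "h \<in> H" "h' \<in> H" "g = h + nmul j x" "g' = h' + nmul j' x"
        by (auto simp: H'_def)
      then show "g + g' \<in> H'"
        using H sum unfolding H'_def add_subgroup_def by blast
    qed
    show "character_on H' \<chi>'"
      unfolding character_on_def
    proof (intro conjI ballI)
      fix g assume "g \<in> H'"
      then show "\<chi>' g \<noteq> 0" using \<chi> y0 \<chi>' by (auto simp: H'_def character_on_def)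
    next
      fix g g' assume "g \<in> H'" "g' \<in> H'"
      then obtain h j h' j' where h: "h \<in> H" "h' \<in> H" "g = h + nmul j x" "g' = h' + nmul j' x"
        by (auto simp: H'_def)
      moreover have "h + h' \<in> H" using h H by (auto simp: add_subgroup_def)
      ultimately show "\<chi>' (g + g') = \<chi>' g * \<chi>' g'"
        using \<chi> by (simp add: sum \<chi>' character_on_def power_add)
    qed
    show "H \<subseteq> H'"
    proof
      fix h assume "h \<in> H"
      moreover have "h = h + nmul 0 x" by simp
      ultimately show "h \<in> H'" unfolding H'_def by blast
    qed
    show "x \<in> H'" unfolding H'_def using H0 by (auto intro!: exI[of _ 0] exI[of _ 1])
    show "\<chi>' g = \<chi> g" if "g \<in> H" for g using \<chi>'[OF that, of 0] by simp
    show "\<chi>' x = y" using \<chi>'[OF H0, of 1] character_on_zero[OF H \<chi>] by simp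
  qed
qed

text \<open>Elements are adjoined one at a time, by induction on the number of elements outside
  \<open>H\<close>. Each step needs an \<open>m\<close>-th root of \<open>\<chi> (nmul m x)\<close>,
  which is found among the powers of \<open>u\<close>.\<close>

lemma character_on_extend:
  fixes H :: "'g::{finite,ab_group_add} set" and u :: "'f::field"
  assumes u: "has_mult_order u (group_exponent TYPE('g))"
    and "add_subgroup H" "character_on H \<chi>"
  shows "\<exists>\<chi>' :: 'g \<Rightarrow> 'f. \<chi>' \<in> characters \<and> (\<forall>g\<in>H. \<chi>' g = \<chi> g)"
  using assms(2,3)
proof (induction "card (- H)" arbitrary: H \<chi> rule: less_induct)
  case less
  note H = less.prems(1) and \<chi> = less.prems(2)
  let ?n = "group_exponent TYPE('g)"
  show ?case
  proof (cases "H = UNIV")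
    case True
    with \<chi> show ?thesis by (auto simp: characters_eq)
  next
    case False
    then obtain x where x: "x \<notin> H" by auto
    obtain m where m: "0 < m" "nmul m x \<in> H" "\<And>j. nmul j x \<in> H \<Longrightarrow> m dvd j"
      by (rule that[OF relative_order[OF H]])
    have "m dvd ?n" using m(3) H by (simp add: nmul_group_exponent add_subgroup_def)
    then obtain d where d: "?n = d * m" by (auto simp: dvd_def mult.commute)
    have d0: "0 < d" using u d by (auto simp: has_mult_order_def)
    \<comment> \<open>Since \<open>d * m\<close> is the exponent, the \<open>d\<close>-th power is
      the value of \<open>\<chi>\<close> at 0.\<close>
    have vd: "\<chi> (nmul m x) ^ d = 1"
      using character_on_nmul[OF H \<chi> m(2), of d] character_on_zero[OF H \<chi>]
      by (simp add: nmul_mult[symmetric] d[symmetric] nmul_group_exponent)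
    then have "\<chi> (nmul m x) ^ ?n = 1" by (simp add: d power_mult)
    \<comment> \<open>The value is \<open>u ^ j\<close> with \<open>u ^ (j * d) = 1\<close>, so
      \<open>d * m\<close> divides \<open>j * d\<close>. Hence \<open>m\<close> divides
      \<open>j\<close>, and the quotient \<open>l\<close> gives the root
      \<open>u ^ l\<close>.\<close>
    then obtain j where j: "\<chi> (nmul m x) = u ^ j" using has_mult_order_root[OF u] by blast
    then have "u ^ (j * d) = 1" using vd by (simp add: power_mult)
    then have "d * m dvd d * j"
      using has_mult_order_dvd[OF u, of "j * d"] d by (simp add: mult.commute)
    then obtain l where "j = l * m" using d0 by (auto simp: dvd_def mult.commute)
    then have y: "(u ^ l) ^ m = \<chi> (nmul m x)" using j by (simp add: power_mult)
    obtain H' \<chi>' where H': "add_subgroup H'" "character_on H' \<chi>'" "H \<subseteq> H'" "x \<in> H'"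
      "\<And>g. g \<in> H \<Longrightarrow> \<chi>' g = \<chi> g"
      by (rule character_on_extend_step[OF H \<chi> m y]) (assumption, rule that)
    have "card (- H') < card (- H)" using H'(3,4) x by (intro psubset_card_mono) auto
    from less.hyps[OF this H'(1,2)] obtain \<chi>'' :: "'g \<Rightarrow> 'f"
      where "\<chi>'' \<in> characters" "\<forall>g\<in>H'. \<chi>'' g = \<chi>' g" by blast
    then show ?thesis using H'(3,5) by (intro exI[of _ \<chi>'']) auto
  qed
qed

text \<open>With \<open>m\<close> the order of \<open>g\<close> and \<open>d * m\<close> the
  exponent, the trivial character of \<open>{0}\<close> extends to one sending \<open>g\<close> to
  \<open>u ^ d\<close>, and then to the whole group. As \<open>g \<noteq> 0\<close> gives
  \<open>m > 1\<close>, \<open>d\<close> lies strictly below the order of \<open>u\<close>.\<close>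

lemma characters_separate:
  fixes g :: "'g::{finite,ab_group_add}" and u :: "'f::field"
  assumes u: "has_mult_order u (group_exponent TYPE('g))" and "g \<noteq> 0"
  shows "\<exists>\<chi> :: 'g \<Rightarrow> 'f. \<chi> \<in> characters \<and> \<chi> g \<noteq> 1"
proof -
  let ?n = "group_exponent TYPE('g)"
  have H: "add_subgroup {0::'g}" and \<chi>: "character_on {0::'g} (\<lambda>_. 1::'f)"
    by (auto simp: add_subgroup_def character_on_def)
  obtain m where m: "0 < m" "nmul m g \<in> {0}" "\<And>j. nmul j g \<in> {0} \<Longrightarrow> m dvd j"
    by (rule that[OF relative_order[OF H]])
  have "m dvd ?n" using m(3) by (simp add: nmul_group_exponent)
  then obtain d where d: "?n = d * m" by (auto simp: dvd_def mult.commute)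
  have n0: "0 < ?n" using u by (simp add: has_mult_order_def)
  have "m \<noteq> 1" using m(2) \<open>g \<noteq> 0\<close> by auto
  then have "0 < d" "d < ?n" using m(1) d n0 by auto
  then have ne: "u ^ d \<noteq> 1" using u by (auto simp: has_mult_order_def)
  have y: "(u ^ d) ^ m = 1" using u d by (simp add: power_mult[symmetric] has_mult_order_def)
  obtain H' \<chi>' where H': "add_subgroup H'" "character_on H' \<chi>'" "{0} \<subseteq> H'" "g \<in> H'"
    "\<And>h. h \<in> {0} \<Longrightarrow> \<chi>' h = 1" "\<chi>' g = u ^ d"
    by (rule character_on_extend_step[OF H \<chi> m y]) (assumption, rule that)
  from character_on_extend[OF u H'(1,2)] obtain \<chi>'' :: "'g \<Rightarrow> 'f"
    where "\<chi>'' \<in> characters" "\<forall>h\<in>H'. \<chi>'' h = \<chi>' h" by blast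
  then show ?thesis using H'(4,6) ne by (intro exI[of _ \<chi>'']) auto
qed

section \<open>The span of the characters\<close>

lemma characters_mult: "\<chi> \<in> characters \<Longrightarrow> \<psi> \<in> characters \<Longrightarrow> (\<lambda>g. \<chi> g * \<psi> g) \<in> characters"
  by (simp add: characters_def)

text \<open>The span of the characters is an algebra, and \<open>\<Prod>h\<noteq>0. (\<chi>\<^sub>h g - \<chi>\<^sub>h h) / (1 - \<chi>\<^sub>h h)\<close>
  is the indicator of 0 when \<open>\<chi>\<^sub>h h \<noteq> 1\<close>.\<close>

lemma delta_in_span_characters:
  fixes u :: "'f::field"
  assumes u: "has_mult_order u (group_exponent TYPE('g::{finite,ab_group_add}))"
  shows "\<exists>xs :: ('f \<times> ('g \<Rightarrow> 'f)) list. snd ` set xs \<subseteq> characters \<and>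
    (\<forall>g. (\<Sum>(c, \<chi>)\<leftarrow>xs. c * \<chi> g) = (if g = 0 then 1 else 0))"
proof -
  \<comment> \<open>The zero set \<open>S\<close> grows by one point at a time. Lists of pairs allow
    a character to recur, so like terms are never collected.\<close>
  have "\<exists>xs :: ('f \<times> ('g \<Rightarrow> 'f)) list. snd ` set xs \<subseteq> characters \<and>
    (\<Sum>(c, \<chi>)\<leftarrow>xs. c * \<chi> 0) = 1 \<and> (\<forall>g\<in>S. (\<Sum>(c, \<chi>)\<leftarrow>xs. c * \<chi> g) = 0)"
    if "0 \<notin> S" for S :: "'g set"
    using finite[of S] that
  proof (induction S)
    case empty
    have "(\<lambda>_. 1) \<in> (characters :: ('g \<Rightarrow> 'f) set)" by (simp add: characters_def)
    then show ?case by (intro exI[of _ "[(1, \<lambda>_. 1)]"]) auto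
  next
    case (insert h S)
    then obtain xs :: "('f \<times> ('g \<Rightarrow> 'f)) list" where xs: "snd ` set xs \<subseteq> characters"
      "(\<Sum>(c, \<chi>)\<leftarrow>xs. c * \<chi> 0) = 1" "\<And>g. g \<in> S \<Longrightarrow> (\<Sum>(c, \<chi>)\<leftarrow>xs. c * \<chi> g) = 0"
      by auto
    obtain \<psi> :: "'g \<Rightarrow> 'f" where \<psi>: "\<psi> \<in> characters" "\<psi> h \<noteq> 1"
      using characters_separate[OF u, of h] insert by auto
    have \<psi>0: "\<psi> 0 = 1"
      using character_on_zero[of UNIV \<psi>] \<psi>(1) by (simp add: characters_eq add_subgroup_def)
    define a where "a = inverse (1 - \<psi> h)"
    \<comment> \<open>\<open>ys\<close> represents the old combination times
      \<open>a * (\<psi> g - \<psi> h)\<close>: the first half multiplies \<open>\<psi>\<close> into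
      the characters, the second carries the constant \<open>- a * \<psi> h\<close>. The new factor
      is 0 at \<open>h\<close> and 1 at 0.\<close>
    define ys where "ys = map (\<lambda>(c, \<chi>). (a * c, \<lambda>g. \<psi> g * \<chi> g)) xs @
      map (\<lambda>(c, \<chi>). (- a * \<psi> h * c, \<chi>)) xs"
    have 1: "(\<Sum>(c, \<chi>)\<leftarrow>map (\<lambda>(c, \<chi>). (a * c, \<lambda>g. \<psi> g * \<chi> g)) zs. c * \<chi> g) =
        a * \<psi> g * (\<Sum>(c, \<chi>)\<leftarrow>zs. c * \<chi> g)" for g and zs :: "('f \<times> ('g \<Rightarrow> 'f)) list"
      by (induction zs) (auto simp: algebra_simps)
    have 2: "(\<Sum>(c, \<chi>)\<leftarrow>map (\<lambda>(c, \<chi>). (- a * \<psi> h * c, \<chi>)) zs. c * \<chi> g) =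
        - a * \<psi> h * (\<Sum>(c, \<chi>)\<leftarrow>zs. c * \<chi> g)" for g and zs :: "('f \<times> ('g \<Rightarrow> 'f)) list"
      by (induction zs) (auto simp: algebra_simps)
    have ys: "(\<Sum>(c, \<chi>)\<leftarrow>ys. c * \<chi> g) = a * (\<psi> g - \<psi> h) * (\<Sum>(c, \<chi>)\<leftarrow>xs. c * \<chi> g)" for g
      unfolding ys_def map_append sum_list_append 1 2 by (simp add: algebra_simps)
    have "snd ` set ys \<subseteq> characters"
      using xs(1) characters_mult[OF \<psi>(1)] by (auto simp: ys_def)
    moreover have "a * (\<psi> 0 - \<psi> h) = 1" using \<psi>0 \<psi>(2) by (simp add: a_def)
    ultimately show ?case using xs(2,3) by (intro exI[of _ ys]) (auto simp: ys)
  qed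
  from this[of "UNIV - {0}"] show ?thesis by force
qed

lemma sum_to_const_poly: "[:\<Sum>s\<in>S. f s:] = (\<Sum>s\<in>S. [:f s::'a::comm_monoid_add:])"
  by (intro poly_eqI) (auto simp: coeff_sum coeff_pCons split: nat.split)

text \<open>Any \<open>f\<close> is a combination of translates of the indicator of 0, and a
  translate of a character is a scalar multiple of it. The coefficients \<open>w s\<close> are
  polynomials, while the characters keep their values in the field and enter as constants.\<close>

lemma function_in_span_characters:
  fixes f :: "'g::{finite,ab_group_add} \<Rightarrow> 'f::field poly" and u :: 'f
  assumes u: "has_mult_order u (group_exponent TYPE('g))"
  obtains n :: nat and w and \<chi> :: "nat \<Rightarrow> 'g \<Rightarrow> 'f" where "\<And>s. s < n \<Longrightarrow> \<chi> s \<in> characters"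
    and "\<And>g. f g = (\<Sum>s<n. w s * [:\<chi> s g:])"
proof -
  obtain xs :: "('f \<times> ('g \<Rightarrow> 'f)) list" where xs: "snd ` set xs \<subseteq> characters"
    "\<And>g. (\<Sum>(c, \<chi>)\<leftarrow>xs. c * \<chi> g) = (if g = 0 then 1 else 0)"
    using delta_in_span_characters[OF u] by auto
  let ?n = "length xs"
  define c where "c s = fst (xs ! s)" for s
  define \<chi> where "\<chi> s = snd (xs ! s)" for s
  define w where "w s = (\<Sum>h\<in>UNIV. f h * [:c s * \<chi> s (- h):])" for s
  have \<chi>: "\<chi> s \<in> characters" if "s < ?n" for s using xs(1) that by (auto simp: \<chi>_def)
  have delta: "(\<Sum>s<?n. c s * \<chi> s g) = (if g = 0 then 1 else 0)" for g
    using xs(2)[of g]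
    by (simp add: sum_list_sum_nth c_def \<chi>_def atLeast0LessThan case_prod_beta)
  have "f g = (\<Sum>s<?n. w s * [:\<chi> s g:])" for g
  proof -
    have "f g = (\<Sum>h\<in>UNIV. f h * (if h = g then 1 else 0))"
      by (simp add: if_distrib cong: if_cong)
    also have "\<dots> = (\<Sum>h\<in>UNIV. f h * [:\<Sum>s<?n. c s * \<chi> s (g + - h):])"
      by (intro sum.cong refl arg_cong2[where f = "(*)"]) (auto simp: delta one_pCons)
    also have "\<dots> = (\<Sum>h\<in>UNIV. f h * (\<Sum>s<?n. [:c s * \<chi> s (g + - h):]))"
      by (simp only: sum_to_const_poly)
    also have "\<dots> = (\<Sum>h\<in>UNIV. \<Sum>s<?n. f h * [:c s * \<chi> s (- h):] * [:\<chi> s g:])"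
      unfolding sum_distrib_left
    proof (intro sum.cong refl)
      fix h s assume "s \<in> {..<?n}"
      then have "\<chi> s (g + - h) = \<chi> s g * \<chi> s (- h)"
        using \<chi>[of s] unfolding characters_def by blast
      then show "f h * [:c s * \<chi> s (g + - h):] = f h * [:c s * \<chi> s (- h):] * [:\<chi> s g:]"
        by (simp add: ac_simps)
    qed
    also have "\<dots> = (\<Sum>s<?n. w s * [:\<chi> s g:])"
      unfolding w_def sum_distrib_right by (rule sum.swap)
    finally show ?thesis .
  qed
  with \<chi> show thesis by (rule that)
qed

section \<open>Nonvanishing minors\<close>

text \<open>Brings nonzero minors back from the polynomial ring to the field: the constant embedding
  is a ring homomorphism and so commutes with \<open>det\<close>.\<close>

lemma det_const_poly: "det (mat k k (\<lambda>(i, j). [:f i j:])) = [:det (mat k k (\<lambda>(i, j). f i j)):]"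
proof -
  interpret comm_ring_hom "\<lambda>x. [:x:]" by unfold_locales (auto simp: one_pCons)
  have "mat k k (\<lambda>(i, j). [:f i j:]) = map_mat (\<lambda>x. [:x:]) (mat k k (\<lambda>(i, j). f i j))"
    by (rule eq_matI) auto
  then show ?thesis by (simp only: hom_det)
qed


theorem theorem1:
  fixes A B :: "'g::{finite,ab_group_add} set"
    and a b :: "nat \<Rightarrow> 'g"
    and k :: nat
  assumes "fully_representable TYPE('g) TYPE('f::field)"
    and "card A = k" and "bij_betw a {..<k} A"
    and "card B = k" and "bij_betw b {..<k} B"
  shows "\<exists>\<chi> :: nat \<Rightarrow> 'g \<Rightarrow> 'f. (\<forall>i<k. \<chi> i \<in> characters) \<and>
           det (mat k k (\<lambda>(i, j). \<chi> i (a j))) \<noteq> 0 \<and>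
           det (mat k k (\<lambda>(i, j). \<chi> i (b j))) \<noteq> 0"
proof -
  obtain u :: 'f where u: "has_mult_order u (group_exponent TYPE('g))"
    using assms(1) by (auto simp: fully_representable_def)
  have inj: "inj_on a {0..<k}" "inj_on b {0..<k}"
    using assms(3,5) by (auto simp: bij_betw_def atLeast0LessThan)
  \<comment> \<open>By cancellation, the addition table \<open>a i + b j\<close> has distinct
    entries in each row and each column.\<close>
  have "\<exists>f :: 'g \<Rightarrow> 'f poly. det (mat k k (\<lambda>(i, j). f (a i + b j))) \<noteq> 0"
    by (rule exists_nonzero_det_poly[of k "\<lambda>i j. a i + b j"]) 
      (auto intro!: inj_onI simp: inj_on_eq_iff[OF inj(1)] inj_on_eq_iff[OF inj(2)])
  then obtain f :: "'g \<Rightarrow> 'f poly" where f: "det (mat k k (\<lambda>(i, j). f (a i + b j))) \<noteq> 0" by blast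
  obtain n w and \<chi> :: "nat \<Rightarrow> 'g \<Rightarrow> 'f" where \<chi>: "\<And>s. s < n \<Longrightarrow> \<chi> s \<in> characters"
    and fw: "\<And>g. f g = (\<Sum>s<n. w s * [:\<chi> s g:])"
    by (rule function_in_span_characters[OF u, of f]) (rule that)
  \<comment> \<open>Multiplicativity of the characters separates \<open>a i\<close> from
    \<open>b j\<close>, as the minor argument requires.\<close>
  have "f (a i + b j) = (\<Sum>s\<in>{..<n}. w s * [:\<chi> s (a i):] * [:\<chi> s (b j):])" for i j
    unfolding fw using \<chi> by (intro sum.cong refl) (simp add: characters_def ac_simps)
  then have nz: "det (mat k k (\<lambda>(i, j). \<Sum>s\<in>{..<n}. w s * [:\<chi> s (a i):] * [:\<chi> s (b j):])) \<noteq> 0"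
    using f by simp
  \<comment> \<open>One selection \<open>\<phi>\<close> serves both minors, so both matrices use the
    same characters.\<close>
  obtain \<phi> where \<phi>: "\<And>i. i < k \<Longrightarrow> \<phi> i \<in> {..<n}"
    and "det (mat k k (\<lambda>(i, j). [:\<chi> (\<phi> i) (a j):])) \<noteq> 0"
    and "det (mat k k (\<lambda>(i, j). [:\<chi> (\<phi> i) (b j):])) \<noteq> 0"
    by (rule common_nonzero_minor[OF finite_lessThan nz]) (rule that)
  then show ?thesis
    using \<chi> by (intro exI[of _ "\<lambda>i. \<chi> (\<phi> i)"]) (auto simp: det_const_poly)
qed

end
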